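(* Let $\Gamma$ be a finitely generated group, $K$ a finite generating set of $\Gamma$, $m$ a weight on $K$, $B$ a strictly convex Banach space, $\pi$ a linear isometric action of $\Gamma$ on $B$ without non-zero invariant vectors, and $1\le r\le\infty$. Then the following are equivalent. (i) There is a constant $C'>0$ such that every $v\in B$ satisfies $\max_{\gamma\in K}\|\pi(\gamma)v-v\|\ge C'\|v\|$. (ii) There is a constant $C>0$ such that every $v\in B\setminus\{0\}$ satisfies $|\nabla_{-}F_{\pi,r}|(v)\ge C$.
   Context: Banach spaces are real or complex. A Banach space $(B,\|\cdot\|)$ is strictly convex if $\|v+u\|<2$ for all $v\neq u$ in $B$ with $\|v\|\le 1$, $\|u\|\le 1$. A weight on $K$ is a function $m:K\to(0,\infty)$ with $\sum_{\gamma\in K}m(\gamma)=1$. A linear isometric action $\pi$ of $\Gamma$ on $B$ is a homomorphism from $\Gamma$ to the group of surjective linear isometries of $B$; it has no non-zero invariant vectors if $\pi(\gamma)v=v$ for all $\gamma\in\Gamma$ implies $v=0$. For $v\in B$ define the displacement function $$F_{\pi,r}(v)=\Big(\sum_{\gamma\in K}\|\pi(\gamma)v-v\|^r m(\gamma)\Big)^{1/r}\ (1\le r<\infty),\qquad F_{\pi,\infty}(v)=\max_{\gamma\in K}\|\pi(\gamma)v-v\|.$$ Its absolute gradient at $v\in B$ is $$|\nabla_{-}F_{\pi,r}|(v)=\max\Big\{\limsup_{u\to v,\ u\in B}\frac{F_{\pi,r}(v)-F_{\pi,r}(u)}{\|v-u\|},\ 0\Big\},$$ where the limsup is over $u\neq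 v$. *)

theory Defs
  imports Complex_Main "HOL-Library.Extended_Real" "HOL-Algebra.Generated_Groups"
begin

text \<open>
  A Banach space over the scalar field \<open>'k\<close> is a type of class \<open>banach\<close> together with a
  multiplication by scalars from \<open>'k\<close> extending the real one and compatible with the norm.
  By Gelfand--Mazur the fields of class \<open>real_normed_field\<close> are, up to isomorphism, exactly
  \<open>real\<close> and \<open>complex\<close>; for \<open>'k = real\<close> the second condition forces \<open>scale = scaleR\<close>.
\<close>

definition banach_scaling :: "('k::real_normed_field \<Rightarrow> 'b::banach \<Rightarrow> 'b) \<Rightarrow> bool" where
  "banach_scaling scale \<longleftrightarrow>
     vector_space scale \<and>
     (\<forall>a v. scale (of_real a) v = a *\<^sub>R v) \<and>
     (\<forall>c v. norm (scale c v) = norm c * norm v)"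

lemma banach_scaling_scaleR: "banach_scaling (scaleR :: real \<Rightarrow> 'b::banach \<Rightarrow> 'b)"
  by (simp add: banach_scaling_def real_vector.vector_space_axioms)

lemma banach_scaling_complex: "banach_scaling ((*) :: complex \<Rightarrow> complex \<Rightarrow> complex)"
  by (auto simp: banach_scaling_def norm_mult scaleR_conv_of_real algebra_simps
      intro!: vector_space.intro)

definition strictly_convex :: "'b::real_normed_vector itself \<Rightarrow> bool" where
  "strictly_convex (_ :: 'b itself) \<longleftrightarrow>
     (\<forall>v u :: 'b. v \<noteq> u \<longrightarrow> norm v \<le> 1 \<longrightarrow> norm u \<le> 1 \<longrightarrow> norm (v + u) < 2)"

definition isometry_group ::
    "('k::real_normed_field \<Rightarrow> 'b::banach \<Rightarrow> 'b) \<Rightarrow> ('b \<Rightarrow> 'b) monoid" where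
  "isometry_group scale =
     \<lparr>carrier = {T. Vector_Spaces.linear scale scale T \<and> surj T \<and> (\<forall>v. norm (T v) = norm v)},
      mult = (\<circ>), one = id\<rparr>"

lemma group_isometry_group:
  assumes "banach_scaling scale"
  shows "group (isometry_group scale)"
proof (rule groupI)
  interpret vector_space scale
    using assms by (simp add: banach_scaling_def)
  show "\<one>\<^bsub>isometry_group scale\<^esub> \<in> carrier (isometry_group scale)"
    using linear_id by (simp add: isometry_group_def id_def)
  fix S assume "S \<in> carrier (isometry_group scale)"
  then have S: "Vector_Spaces.linear scale scale S" "surj S" "\<And>v. norm (S v) = norm v"
    by (auto simp: isometry_group_def)
  let ?I = "inv_into UNIV S"
  interpret S: Vector_Spaces.linear scale scale S by (rule S(1))
  have "inj S"
    using S(3) by (intro injI) (metis S.diff norm_eq_zero right_minus_eq)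
  then have bij: "bij S" using S(2) by (simp add: bij_def)
  have r: "S (?I v) = v" for v using S(2) by (simp add: surj_f_inv_f)
  have "Vector_Spaces.linear scale scale (?I)"
  proof (unfold_locales)
    show "?I (x + y) = ?I x + ?I y" for x y
      by (metis \<open>inj S\<close> S.add injD r)
    show "?I (scale c x) = scale c (?I x)" for c x
      by (metis \<open>inj S\<close> S.scale injD r)
  qed
  moreover have "surj (?I)" using bij by (simp add: bij_imp_bij_inv bij_is_surj)
  moreover have "norm (?I v) = norm v" for v by (metis S(3) r)
  ultimately show "\<exists>T\<in>carrier (isometry_group scale).
      T \<otimes>\<^bsub>isometry_group scale\<^esub> S = \<one>\<^bsub>isometry_group scale\<^esub>"
    using \<open>inj S\<close> by (intro bexI[of _ "?I"]) (auto simp: isometry_group_def)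
  fix T assume T: "T \<in> carrier (isometry_group scale)"
  then have "Vector_Spaces.linear scale scale (T \<circ> S)"
    by (intro Vector_Spaces.linear_compose[OF S(1)]) (simp add: isometry_group_def)
  moreover have "surj (T \<circ> S)" using S(2) T by (intro comp_surj) (simp_all add: isometry_group_def)
  ultimately show "T \<otimes>\<^bsub>isometry_group scale\<^esub> S \<in> carrier (isometry_group scale)"
    using S T by (simp add: isometry_group_def)
qed (simp_all add: isometry_group_def comp_assoc)

text \<open>\<open>1 \<le> r \<le> \<infinity>\<close> is an extended real; for finite \<open>r\<close> all bases of \<open>powr\<close> are nonnegative
  and \<open>0 powr r = 0\<close>.\<close>

definition displacement ::
    "'g set \<Rightarrow> ('g \<Rightarrow> real) \<Rightarrow> ('g \<Rightarrow> 'b::banach \<Rightarrow> 'b) \<Rightarrow> ereal \<Rightarrow> 'b \<Rightarrow> real" where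
  "displacement K m \<pi> r v =
     (if r = \<infinity> then Max ((\<lambda>\<gamma>. norm (\<pi> \<gamma> v - v)) ` K)
      else (\<Sum>\<gamma>\<in>K. norm (\<pi> \<gamma> v - v) powr real_of_ereal r * m \<gamma>) powr (1 / real_of_ereal r))"

definition abs_gradient :: "('b::real_normed_vector \<Rightarrow> real) \<Rightarrow> 'b \<Rightarrow> ereal" where
  "abs_gradient F v = max (Limsup (at v) (\<lambda>u. ereal ((F v - F u) / norm (v - u)))) 0"

end

(* For (i) ==> (ii), the displacement function F is positively homogeneous, so moving from v towards 0
   decreases it at the rate F v / norm v.  For (ii) ==> (i), fix 0 < c < C.  If F v < c * norm v,
   Ekeland's variational principle gives w with norm (w - v) < norm v, hence w nonzero,
   such that F decreases from w at rate at most c, so the absolute gradient at w is below C. *)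

theory Submission
  imports Defs
begin

section \<open>Ekeland's variational principle in a complete metric space\<close>

theorem ekeland_variational_principle:
  fixes f :: "'a::complete_space \<Rightarrow> real"
  assumes cont: "continuous_on UNIV f"
    and bdd: "bdd_below (range f)"
    and c: "c > 0"
  obtains w where "f w + c * dist w v \<le> f v"
    and "\<And>u. u \<noteq> w \<Longrightarrow> f w - c * dist u w < f u"
proof -
  \<comment> \<open>\<open>S x\<close> is the set of points below \<open>x\<close> in a partial
    order, transitive by the triangle inequality. The required \<open>w\<close> is a minimal element
    below \<open>v\<close>, that is, \<open>w \<in> S v\<close> and \<open>S w = {w}\<close>; it is
    found as the limit of a descending sequence.\<close>
  define S where "S x = {u. f u + c * dist u x \<le> f x}" for x
  have S_self: "x \<in> S x" for x by (simp add: S_def)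
  have S_trans: "z \<in> S x" if "y \<in> S x" "z \<in> S y" for x y z
  proof -
    have "c * dist z x \<le> c * (dist z y + dist y x)"
      using c by (intro mult_left_mono dist_triangle) auto
    then show ?thesis using that by (simp add: S_def algebra_simps)
  qed
  have bddS: "bdd_below (f ` S x)" for x
    using bdd by (rule bdd_below_mono) auto
  \<comment> \<open>Each step descends at least half of the way from \<open>f x\<close> to the
    infimum of \<open>f\<close> over \<open>S x\<close>. This infimum need not be attained, so when
    it lies below \<open>f x\<close> the midpoint serves as the target; otherwise \<open>x\<close>
    itself will do.\<close>
  have ex_step: "\<exists>y. y \<in> S x \<and> 2 * f y \<le> f x + Inf (f ` S x)" for x
  proof (cases "Inf (f ` S x) < f x")
    case True
    then have "Inf (f ` S x) < (f x + Inf (f ` S x)) / 2" by simp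
    then obtain y where "y \<in> S x" "f y < (f x + Inf (f ` S x)) / 2"
      using S_self bddS cInf_less_iff[of "f ` S x"] by blast
    then show ?thesis by (intro exI[of _ y]) auto
  next
    case False
    then show ?thesis using S_self by (intro exI[of _ x]) auto
  qed
  then obtain g where g: "\<And>x. g x \<in> S x" "\<And>x. 2 * f (g x) \<le> f x + Inf (f ` S x)"
    by metis
  define X where "X n = (g ^^ n) v" for n
  have X_Suc: "X (Suc n) = g (X n)" for n by (simp add: X_def)
  have X_S: "X (n + k) \<in> S (X n)" for n k
  proof (induction k)
    case 0
    then show ?case by (simp add: S_self)
  next
    case (Suc k)
    then show ?case using S_trans g(1)[of "X (n + k)"] by (simp add: X_Suc)
  qed
  have dist_le: "c * dist (X k) (X n) \<le> f (X n) - f (X k)" if "n \<le> k" for n k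
    using X_S[of n "k - n"] that by (simp add: S_def)
  \<comment> \<open>The values of \<open>f\<close> decrease and are bounded below, hence form a
    Cauchy sequence. By \<open>dist_le\<close> they control the distances between the points, so
    \<open>X\<close> is Cauchy as well.\<close>
  have "decseq (\<lambda>n. f (X n))"
  proof (rule decseq_SucI)
    show "f (X (Suc n)) \<le> f (X n)" for n
      using dist_le[of n "Suc n"] c
      by (smt (verit) lessI less_imp_le mult_nonneg_nonneg zero_le_dist)
  qed
  moreover obtain b where "\<And>x. b \<le> f x"
    using bdd by (auto simp: bdd_below_def)
  ultimately obtain L where L: "(\<lambda>n. f (X n)) \<longlonglongrightarrow> L"
    by (metis decseq_convergent)
  then have "Cauchy (\<lambda>n. f (X n))" by (rule LIMSEQ_imp_Cauchy)
  have "Cauchy X"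
  proof (rule metric_CauchyI)
    fix e :: real assume "e > 0"
    then obtain M where M: "\<And>i j. i \<ge> M \<Longrightarrow> j \<ge> M \<Longrightarrow> dist (f (X i)) (f (X j)) < c * e"
      using c \<open>Cauchy (\<lambda>n. f (X n))\<close> metric_CauchyD[of "\<lambda>n. f (X n)" "c * e"] by auto
    have "dist (X i) (X j) < e" if "i \<ge> M" "j \<ge> M" for i j
    proof -
      have "c * dist (X i) (X j) \<le> dist (f (X i)) (f (X j))"
        using dist_le[of i j] dist_le[of j i]
        by (cases i j rule: linorder_le_cases) (auto simp: dist_real_def dist_commute)
      also have "\<dots> < c * e" using M that by blast
      finally show ?thesis using c by simp
    qed
    then show "\<exists>M. \<forall>i\<ge>M. \<forall>j\<ge>M. dist (X i) (X j) < e" by blast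
  qed
  then obtain w where w: "X \<longlonglongrightarrow> w"
    by (metis Cauchy_convergent convergent_def)
  have fw: "(\<lambda>n. f (X n)) \<longlonglongrightarrow> f w"
    using continuous_on_tendsto_compose[OF cont w] by simp
  \<comment> \<open>Each \<open>S (X n)\<close> is closed and contains all later terms, so it
    contains their limit.\<close>
  have w_S: "w \<in> S (X n)" for n
  proof -
    have "f w + c * dist w (X n) \<le> f (X n)"
    proof (rule LIMSEQ_le_const2)
      show "(\<lambda>k. f (X k) + c * dist (X k) (X n)) \<longlonglongrightarrow> f w + c * dist w (X n)"
        by (intro tendsto_intros fw w)
      show "\<exists>N. \<forall>k\<ge>N. f (X k) + c * dist (X k) (X n) \<le> f (X n)"
        using dist_le[of n] by (intro exI[of _ n]) (auto simp: algebra_simps)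
    qed
    then show ?thesis by (simp add: S_def)
  qed
  \<comment> \<open>By transitivity \<open>u\<close> lies in every \<open>S (X n)\<close>, so
    \<open>f u\<close> is at least each infimum. The halving rule bounds these infima below by a
    sequence tending to \<open>f w\<close>; thus \<open>u\<close> cannot lower \<open>f\<close>, and
    membership in \<open>S w\<close> leaves no room for a positive distance.\<close>
  have "u = w" if u: "u \<in> S w" for u
  proof -
    have "2 * f (X (Suc n)) - f (X n) \<le> f u" for n
    proof -
      have "Inf (f ` S (X n)) \<le> f u"
        using S_trans[OF w_S u] bddS by (intro cInf_lower) auto
      then show ?thesis using g(2)[of "X n"] by (simp add: X_Suc)
    qed
    moreover have "(\<lambda>n. 2 * f (X (Suc n)) - f (X n)) \<longlonglongrightarrow> 2 * f w - f w"
      by (intro tendsto_intros fw LIMSEQ_Suc[OF fw])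
    ultimately have "f w \<le> f u"
      using LIMSEQ_le_const2[of _ "2 * f w - f w" "f u"] by auto
    then have "c * dist u w \<le> 0" using u by (simp add: S_def)
    then show ?thesis using c by (simp add: mult_le_0_iff)
  qed
  then have "f w - c * dist u w < f u" if "u \<noteq> w" for u
    using that by (force simp: S_def)
  moreover have "f w + c * dist w v \<le> f v"
    using w_S[of 0] by (simp add: S_def X_def)
  ultimately show ?thesis using that by blast
qed

section \<open>Absolute gradients and linear lower bounds\<close>

lemma le_if_abs_gradient_gt:
  fixes F :: "'b::banach \<Rightarrow> real"
  assumes cont: "continuous_on UNIV F" and nonneg: "\<And>v. F v \<ge> 0" and c: "c > 0"
    and grad: "\<And>v. v \<noteq> 0 \<Longrightarrow> abs_gradient F v > ereal c"
  shows "c * norm v \<le> F v"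
proof (rule ccontr)
  assume less: "\<not> c * norm v \<le> F v"
  have "bdd_below (range F)" using nonneg by (intro bdd_belowI2)
  from ekeland_variational_principle[OF cont this c, of v]
  obtain w where w: "F w + c * dist w v \<le> F v" "\<And>u. u \<noteq> w \<Longrightarrow> F w - c * dist u w < F u"
    by blast
  have "c * dist w v < c * norm v" using w(1) nonneg[of w] less by linarith
  then have "w \<noteq> 0" using c by auto
  \<comment> \<open>Minimality of \<open>w\<close> bounds the difference quotient for all
    \<open>u \<noteq> w\<close>, not only for those near \<open>w\<close>, so the limsup is bounded
    by \<open>c\<close>. The truncation at 0 in the gradient does no harm since
    \<open>c > 0\<close>.\<close>
  have "(F w - F u) / norm (w - u) \<le> c" if "u \<noteq> w" for u
    using w(2)[OF that] that by (simp add: divide_simps dist_norm norm_minus_commute)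
  then have "Limsup (at w) (\<lambda>u. ereal ((F w - F u) / norm (w - u))) \<le> ereal c"
    by (intro Limsup_bounded) (auto simp: eventually_at_filter)
  then have "abs_gradient F w \<le> ereal c"
    using c by (simp add: abs_gradient_def)
  with grad[OF \<open>w \<noteq> 0\<close>] show False by simp
qed

text \<open>On the segment from \<open>v\<close> to 0 the difference quotient is constantly
  \<open>F v / norm v\<close>. Such points exist arbitrarily close to \<open>v\<close>, so the
  limsup cannot be smaller.\<close>

lemma abs_gradient_homogeneous_ge:
  fixes F :: "'b::real_normed_vector \<Rightarrow> real"
  assumes hom: "\<And>a v. a \<ge> 0 \<Longrightarrow> F (a *\<^sub>R v) = a * F v" and v: "v \<noteq> 0"
  shows "abs_gradient F v \<ge> ereal (F v / norm v)"
proof -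
  let ?q = "\<lambda>u. ereal ((F v - F u) / norm (v - u))"
  have "ereal (F v / norm v) \<le> Limsup (at v) ?q"
  proof (rule ccontr)
    assume "\<not> ereal (F v / norm v) \<le> Limsup (at v) ?q"
    then have "eventually (\<lambda>u. ?q u < ereal (F v / norm v)) (at v)"
      by (intro Limsup_lessD) simp
    then obtain d where "d > 0"
      and d: "\<And>u. u \<noteq> v \<Longrightarrow> dist u v < d \<Longrightarrow> ?q u < ereal (F v / norm v)"
      by (auto simp: eventually_at)
    \<comment> \<open>The bound 1/2 keeps \<open>1 - t\<close> positive, so that homogeneity
      applies; the other bound puts \<open>u\<close> within \<open>d / 2\<close> of
      \<open>v\<close>.\<close>
    define t where "t = min (1/2) (d / (2 * norm v))"
    have t: "0 < t" "t < 1" using v \<open>d > 0\<close> by (auto simp: t_def)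
    have "t * norm v \<le> d / (2 * norm v) * norm v"
      by (intro mult_right_mono) (auto simp: t_def)
    then have "t * norm v < d" using v \<open>d > 0\<close> by simp
    define u where "u = (1 - t) *\<^sub>R v"
    have "v - u = t *\<^sub>R v" by (simp add: u_def algebra_simps)
    then have n: "norm (v - u) = t * norm v" using t by simp
    have "u \<noteq> v" using n t v by auto
    moreover have "dist u v < d" using n \<open>t * norm v < d\<close> by (simp add: dist_norm norm_minus_commute)
    ultimately have "?q u < ereal (F v / norm v)" by (rule d)
    moreover have "F v - F u = t * F v" using t hom[of "1 - t" v] by (simp add: u_def algebra_simps)
    ultimately show False using n t by simp
  qed
  then show ?thesis by (simp add: abs_gradient_def le_max_iff_disj)
qed

section \<open>Bounds, homogeneity and continuity of the displacement function\<close>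

lemma continuous_on_Max_image:
  fixes f :: "'i \<Rightarrow> 'a::topological_space \<Rightarrow> 'b::linorder_topology"
  assumes "finite K" "K \<noteq> {}" "\<And>i. i \<in> K \<Longrightarrow> continuous_on S (f i)"
  shows "continuous_on S (\<lambda>x. Max ((\<lambda>i. f i x) ` K))"
  using assms
proof (induction K rule: finite_ne_induct)
  case (singleton i)
  then show ?case by simp
next
  case (insert i K)
  then have "continuous_on S (\<lambda>x. max (f i x) (Max ((\<lambda>i. f i x) ` K)))"
    by (intro continuous_on_max) auto
  then show ?case using insert by simp
qed

lemma displacement_nonneg:
  assumes "finite K" "K \<noteq> {}"
  shows "displacement K m \<pi> r v \<ge> 0"
  using assms by (auto simp: displacement_def Max_ge_iff)

text \<open>For finite \<open>r\<close> this is a power mean with weights of total mass 1, so it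
  cannot exceed the largest entry; for infinite \<open>r\<close> equality holds.\<close>

lemma displacement_le_Max:
  assumes K: "finite K" "K \<noteq> {}" and m: "\<And>\<gamma>. \<gamma> \<in> K \<Longrightarrow> m \<gamma> > 0" "(\<Sum>\<gamma>\<in>K. m \<gamma>) = 1"
    and r: "1 \<le> r"
  shows "displacement K m \<pi> r v \<le> Max ((\<lambda>\<gamma>. norm (\<pi> \<gamma> v - v)) ` K)"
proof (cases r)
  case (real p)
  then have p: "p \<ge> 1" using r by simp
  let ?M = "Max ((\<lambda>\<gamma>. norm (\<pi> \<gamma> v - v)) ` K)"
  have M: "norm (\<pi> \<gamma> v - v) \<le> ?M" if "\<gamma> \<in> K" for \<gamma> using K that by simp
  have M0: "?M \<ge> 0" using K by (auto simp: Max_ge_iff)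
  have "(\<Sum>\<gamma>\<in>K. norm (\<pi> \<gamma> v - v) powr p * m \<gamma>) \<le> (\<Sum>\<gamma>\<in>K. ?M powr p * m \<gamma>)"
    using M p m(1) by (intro sum_mono mult_right_mono powr_mono2) (auto intro: less_imp_le)
  also have "\<dots> = ?M powr p" by (simp add: sum_distrib_left[symmetric] m(2))
  finally have "(\<Sum>\<gamma>\<in>K. norm (\<pi> \<gamma> v - v) powr p * m \<gamma>) powr (1 / p) \<le> (?M powr p) powr (1 / p)"
    using p by (intro powr_mono2 sum_nonneg mult_nonneg_nonneg less_imp_le[OF m(1)]) auto
  then show ?thesis using real p M0 by (simp add: displacement_def powr_powr)
qed (use r in \<open>auto simp: displacement_def\<close>)

text \<open>For finite \<open>r = p\<close>, keeping only the term of a generator that attains the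
  maximum leaves the factor \<open>m \<gamma> powr (1 / p)\<close>. Since
  \<open>m \<gamma> \<le> 1\<close> and \<open>p \<ge> 1\<close>, this is at least
  \<open>m \<gamma>\<close>, which gives a constant independent of \<open>r\<close>.\<close>

lemma displacement_ge_Max:
  assumes K: "finite K" "K \<noteq> {}" and m: "\<And>\<gamma>. \<gamma> \<in> K \<Longrightarrow> m \<gamma> > 0" "(\<Sum>\<gamma>\<in>K. m \<gamma>) = 1"
    and r: "1 \<le> r"
  shows "Min (m ` K) * Max ((\<lambda>\<gamma>. norm (\<pi> \<gamma> v - v)) ` K) \<le> displacement K m \<pi> r v"
proof -
  let ?M = "Max ((\<lambda>\<gamma>. norm (\<pi> \<gamma> v - v)) ` K)"
  have "?M \<in> (\<lambda>\<gamma>. norm (\<pi> \<gamma> v - v)) ` K" using K by (intro Max_in) auto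
  then obtain \<gamma> where \<gamma>: "\<gamma> \<in> K" and M: "?M = norm (\<pi> \<gamma> v - v)" by blast
  have Min: "Min (m ` K) \<le> m \<gamma>" using K \<gamma> by simp
  have m1: "m \<gamma> \<le> 1" unfolding m(2)[symmetric]
    using K \<gamma> m(1) by (intro member_le_sum) (auto intro: less_imp_le)
  show ?thesis
  proof (cases r)
    case (real p)
    then have p: "p \<ge> 1" using r by simp
    have "Min (m ` K) * ?M \<le> m \<gamma> powr 1 * ?M"
      using Min m(1)[OF \<gamma>] by (simp add: M mult_right_mono)
    also have "\<dots> \<le> m \<gamma> powr (1 / p) * ?M"
      using m(1)[OF \<gamma>] m1 p by (intro mult_right_mono powr_mono') (auto simp: M)
    also have "\<dots> = (norm (\<pi> \<gamma> v - v) powr p * m \<gamma>) powr (1 / p)"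
      using p m(1)[OF \<gamma>] by (simp add: M powr_mult powr_powr)
    also have "\<dots> \<le> (\<Sum>\<gamma>\<in>K. norm (\<pi> \<gamma> v - v) powr p * m \<gamma>) powr (1 / p)"
      using p K \<gamma>
      by (intro powr_mono2 mult_nonneg_nonneg less_imp_le[OF m(1)]
          member_le_sum[of _ _ "\<lambda>\<gamma>. norm (\<pi> \<gamma> v - v) powr p * m \<gamma>"]) auto
    finally show ?thesis using real by (simp add: displacement_def)
  next
    case PInf
    have "Min (m ` K) * ?M \<le> 1 * ?M"
      using Min m1 by (intro mult_right_mono) (auto simp: M)
    then show ?thesis using PInf by (simp add: displacement_def)
  qed (use r in auto)
qed

lemma displacement_scaleR:
  assumes K: "finite K" "K \<noteq> {}" and r: "1 \<le> r"
    and hom: "\<And>\<gamma>. \<gamma> \<in> K \<Longrightarrow> \<pi> \<gamma> (a *\<^sub>R v) = a *\<^sub>R \<pi> \<gamma> v" and a: "a \<ge> 0"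
  shows "displacement K m \<pi> r (a *\<^sub>R v) = a * displacement K m \<pi> r v"
proof -
  have n: "norm (\<pi> \<gamma> (a *\<^sub>R v) - a *\<^sub>R v) = a * norm (\<pi> \<gamma> v - v)" if "\<gamma> \<in> K" for \<gamma>
    using a by (simp add: hom[OF that] flip: scaleR_diff_right)
  show ?thesis
  proof (cases r)
    case (real p)
    then have p: "p \<ge> 1" using r by simp
    have "(\<Sum>\<gamma>\<in>K. norm (\<pi> \<gamma> (a *\<^sub>R v) - a *\<^sub>R v) powr p * m \<gamma>)
        = a powr p * (\<Sum>\<gamma>\<in>K. norm (\<pi> \<gamma> v - v) powr p * m \<gamma>)"
      using a by (simp add: n powr_mult sum_distrib_left mult.assoc)
    then show ?thesis using real p a by (simp add: displacement_def powr_mult powr_powr)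
  next
    case PInf
    have "mono ((*) a)" using a by (simp add: mono_def mult_left_mono)
    then have "a * Max ((\<lambda>\<gamma>. norm (\<pi> \<gamma> v - v)) ` K)
        = Max ((*) a ` (\<lambda>\<gamma>. norm (\<pi> \<gamma> v - v)) ` K)"
      using K by (intro mono_Max_commute) auto
    also have "(*) a ` (\<lambda>\<gamma>. norm (\<pi> \<gamma> v - v)) ` K = (\<lambda>\<gamma>. norm (\<pi> \<gamma> (a *\<^sub>R v) - a *\<^sub>R v)) ` K"
      by (auto simp: n image_image)
    finally show ?thesis using PInf by (simp add: displacement_def)
  qed (use r in auto)
qed

lemma continuous_on_displacement:
  assumes K: "finite K" "K \<noteq> {}" and r: "1 \<le> r" and m: "\<And>\<gamma>. \<gamma> \<in> K \<Longrightarrow> m \<gamma> \<ge> 0"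
    and cont: "\<And>\<gamma>. \<gamma> \<in> K \<Longrightarrow> continuous_on S (\<pi> \<gamma>)"
  shows "continuous_on S (displacement K m \<pi> r)"
proof (cases r)
  case (real p)
  then have p: "p \<ge> 1" using r by simp
  \<comment> \<open>The bases may vanish, for instance at \<open>v\<close> fixed by every generator
    in \<open>K\<close>. Continuity of \<open>powr\<close> at base 0 relies on nonnegative bases and
    positive exponents.\<close>
  have "continuous_on S (\<lambda>v. (\<Sum>\<gamma>\<in>K. norm (\<pi> \<gamma> v - v) powr p * m \<gamma>) powr (1 / p))"
    using p m by (intro continuous_on_powr' continuous_intros cont) (auto intro!: sum_nonneg)
  then show ?thesis using real by (simp add: displacement_def[abs_def])
next
  case PInf
  have "continuous_on S (\<lambda>v. Max ((\<lambda>\<gamma>. norm (\<pi> \<gamma> v - v)) ` K))"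
    using K by (intro continuous_on_Max_image continuous_intros cont)
  then show ?thesis using PInf by (simp add: displacement_def[abs_def])
qed (use r in auto)

section \<open>Linear isometries and the equivalence\<close>

lemma isometry_groupD:
  assumes "banach_scaling scale" "T \<in> carrier (isometry_group scale)"
  shows "T (a *\<^sub>R v) = a *\<^sub>R T v" "continuous_on S T"
proof -
  interpret T: Vector_Spaces.linear scale scale T
    using assms(2) by (simp add: isometry_group_def)
  show "T (a *\<^sub>R v) = a *\<^sub>R T v"
    \<comment> \<open>Linearity is over the field \<open>'k\<close>; real scalars enter it through
      \<open>of_real\<close>, where \<open>scale\<close> agrees with \<open>scaleR\<close>.\<close>
    using assms(1) T.scale[of "of_real a" v] by (simp add: banach_scaling_def)
  have "dist (T x) (T y) = dist x y" for x y
    using assms(2) by (simp add: isometry_group_def dist_norm flip: T.diff)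
  then show "continuous_on S T"
    by (intro uniformly_continuous_imp_continuous) (auto simp: uniformly_continuous_on_def)
qed

theorem theorem1p1:
  fixes \<Gamma> :: "('g, 'x) monoid_scheme"
    and K :: "'g set"
    and m :: "'g \<Rightarrow> real"
    and scale :: "'k::real_normed_field \<Rightarrow> 'b::banach \<Rightarrow> 'b"
    and \<pi> :: "'g \<Rightarrow> 'b \<Rightarrow> 'b"
    and r :: ereal
  assumes "group \<Gamma>"
    and "finite K" and "K \<subseteq> carrier \<Gamma>" and "generate \<Gamma> K = carrier \<Gamma>"
    and "\<forall>\<gamma>\<in>K. m \<gamma> > 0" and "(\<Sum>\<gamma>\<in>K. m \<gamma>) = 1"
    and "banach_scaling scale"
    and "strictly_convex TYPE('b)"
    and "\<pi> \<in> hom \<Gamma> (isometry_group scale)"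
    and "\<forall>v. (\<forall>\<gamma>\<in>carrier \<Gamma>. \<pi> \<gamma> v = v) \<longrightarrow> v = 0"
    and "1 \<le> r"
  shows "(\<exists>C'::real. C' > 0 \<and> (\<forall>v. Max ((\<lambda>\<gamma>. norm (\<pi> \<gamma> v - v)) ` K) \<ge> C' * norm v)) \<longleftrightarrow>
         (\<exists>C::real. C > 0 \<and> (\<forall>v. v \<noteq> 0 \<longrightarrow> abs_gradient (displacement K m \<pi> r) v \<ge> ereal C))"
proof -
  let ?F = "displacement K m \<pi> r"
  let ?M = "\<lambda>v. Max ((\<lambda>\<gamma>. norm (\<pi> \<gamma> v - v)) ` K)"
  note K = \<open>finite K\<close> and r = \<open>1 \<le> r\<close> and sum_m = \<open>(\<Sum>\<gamma>\<in>K. m \<gamma>) = 1\<close>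
  have ne: "K \<noteq> {}" using sum_m by auto
  have m: "m \<gamma> > 0" if "\<gamma> \<in> K" for \<gamma> using assms(5) that by blast
  have \<pi>: "\<pi> \<gamma> \<in> carrier (isometry_group scale)" if "\<gamma> \<in> K" for \<gamma>
    using assms(3,9) that by (auto simp: hom_def)
  note iso = isometry_groupD[OF \<open>banach_scaling scale\<close> \<pi>]
  show ?thesis
  proof
    assume "\<exists>C'>0. \<forall>v. ?M v \<ge> C' * norm v"
    then obtain C' where C': "C' > 0" "\<And>v. C' * norm v \<le> ?M v" by blast
    \<comment> \<open>The smallest weight is the price of comparing the maximum with the
      displacement function; times \<open>C'\<close> it is the constant for the gradient.\<close>
    have Min: "Min (m ` K) > 0" using K ne m by simp
    have "ereal (Min (m ` K) * C') \<le> abs_gradient ?F v" if "v \<noteq> 0" for v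
    proof -
      have "Min (m ` K) * (C' * norm v) \<le> Min (m ` K) * ?M v"
        using Min by (intro mult_left_mono C'(2)) simp
      also have "\<dots> \<le> ?F v" using displacement_ge_Max[OF K ne m sum_m r] by simp
      finally have "ereal (Min (m ` K) * C') \<le> ereal (?F v / norm v)"
        using that by (simp add: field_simps)
      also have "\<dots> \<le> abs_gradient ?F v"
        using that by (intro abs_gradient_homogeneous_ge displacement_scaleR K ne r iso(1))
      finally show ?thesis .
    qed
    then show "\<exists>C>0. \<forall>v. v \<noteq> 0 \<longrightarrow> ereal C \<le> abs_gradient ?F v"
      using Min C'(1) by (intro exI[of _ "Min (m ` K) * C'"]) simp
  next
    assume "\<exists>C>0. \<forall>v. v \<noteq> 0 \<longrightarrow> ereal C \<le> abs_gradient ?F v"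
    then obtain C where C: "C > 0" "\<And>v. v \<noteq> 0 \<Longrightarrow> ereal C \<le> abs_gradient ?F v" by blast
    \<comment> \<open>Halving \<open>C\<close> turns the weak bound into the strict one that the
      variational argument contradicts.\<close>
    have grad: "ereal (C / 2) < abs_gradient ?F v" if "v \<noteq> 0" for v
      using C(1) C(2)[OF that] by (intro less_le_trans[OF _ C(2)[OF that]]) simp
    have "continuous_on UNIV ?F"
      by (intro continuous_on_displacement K ne r iso(2) less_imp_le[OF m])
    then have "C / 2 * norm v \<le> ?F v" for v
      using C(1) grad displacement_nonneg[OF K ne] by (intro le_if_abs_gradient_gt) auto
    \<comment> \<open>Passing from the displacement function up to the maximum costs no
      constant.\<close>
    then have "C / 2 * norm v \<le> ?M v" for v
      using displacement_le_Max[OF K ne m sum_m r] order_trans by blast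
    then show "\<exists>C'>0. \<forall>v. ?M v \<ge> C' * norm v"
      using C(1) by (intro exI[of _ "C / 2"]) simp
  qed
qed

end
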